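(* Let $n\geq 3$, let $I_n=\{0,\ldots,n-1\}$, and let $L$ be the set of strings $u\in\{0,1\}^n$ such that the number of $1$'s in $u$ is either $1$ or $n$. The minimal simplicial complexes over $I_n$ generating $L$ are exactly the complexes whose maximal simplices are $I_n\setminus\{a\}$ and $I_n\setminus\{b\}$, for distinct $a,b\in I_n$.
   Context: All sets are finite (possibly empty). For $f:B^J\to A^I$ write $f_i(x)=f(x)_i$. For $i\in I$, the input window $\mathcal{W}_f(i)$ is the smallest set $W\subseteq J$ (it exists) such that for all $x,y\in B^J$, $x|_W=y|_W$ implies $f_i(x)=f_i(y)$. A simplicial complex (or complex) over $I$ is a collection of subsets of $I$ (its simplices) closed under taking subsets; the empty set is a simplex of every complex. The communication complex $K_f$ of $f$ is the complex over $I$ in which a non-empty $S\subseteq I$ is a simplex iff $\bigcap_{i\in S}\mathcal{W}_f(i)\neq\emptyset$. A complex $K$ over $I$ generates a language $L\subseteq A^I$ if there exist finite sets $B,J$ and a function $f:B^J\to A^I$ with image exactly $L$ and $K_f\subseteq K$. A complex generating $L$ is minimal if no complex strictly contained in it generates $L$. We write $\{0,1\}^n$ for $\{0,1\}^{I_n}$. *)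

theory Defs
  imports Main "HOL-Library.FuncSet"
begin

text \<open>
  For sets \<open>B\<close> and \<open>J\<close>, the set of families \<open>B\<^sup>J\<close> is the extensional function space
  \<open>J \<rightarrow>\<^sub>E B\<close>. A map \<open>f : B\<^sup>J \<rightarrow> A\<^sup>I\<close> is a HOL function of which only the values on
  \<open>J \<rightarrow>\<^sub>E B\<close> matter; \<open>f\<^sub>i(x)\<close> is \<open>f x i\<close>.
\<close>

definition determines ::
  "'j set \<Rightarrow> 'b set \<Rightarrow> (('j \<Rightarrow> 'b) \<Rightarrow> ('i \<Rightarrow> 'a)) \<Rightarrow> 'i \<Rightarrow> 'j set \<Rightarrow> bool" where
  "determines J B f i W \<longleftrightarrow>
     (\<forall>x \<in> J \<rightarrow>\<^sub>E B. \<forall>y \<in> J \<rightarrow>\<^sub>E B. restrict x W = restrict y W \<longrightarrow> f x i = f y i)"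

text \<open>The order on sets is inclusion, so \<open>LEAST\<close> is the smallest set with the given property.\<close>

definition input_window ::
  "'j set \<Rightarrow> 'b set \<Rightarrow> (('j \<Rightarrow> 'b) \<Rightarrow> ('i \<Rightarrow> 'a)) \<Rightarrow> 'i \<Rightarrow> 'j set" where
  "input_window J B f i = (LEAST W. W \<subseteq> J \<and> determines J B f i W)"

lemma determines_Int:
  assumes W: "W \<subseteq> J" "determines J B f i W" and V: "V \<subseteq> J" "determines J B f i V"
  shows "determines J B f i (W \<inter> V)"
  unfolding determines_def
proof (intro ballI impI)
  fix x y
  assume x: "x \<in> J \<rightarrow>\<^sub>E B" and y: "y \<in> J \<rightarrow>\<^sub>E B"
    and eq: "restrict x (W \<inter> V) = restrict y (W \<inter> V)"
  have eq': "x j = y j" if "j \<in> W" "j \<in> V" for j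
    using fun_cong[OF eq, of j] that by simp
  define z where "z = (\<lambda>j. if j \<in> W then x j else y j)"
  have z: "z \<in> J \<rightarrow>\<^sub>E B"
    using x y W(1) by (auto simp: z_def PiE_iff extensional_def)
  have xz: "restrict x W = restrict z W"
    by (rule restrict_ext) (simp add: z_def)
  have zy: "restrict z V = restrict y V"
    by (rule restrict_ext) (simp add: z_def eq')
  have "f x i = f z i"
    using W(2)[unfolded determines_def, rule_format, OF x z xz] .
  also have "\<dots> = f y i"
    using V(2)[unfolded determines_def, rule_format, OF z y zy] .
  finally show "f x i = f y i" .
qed

lemma input_window_least:
  assumes "finite J"
  shows "input_window J B f i \<subseteq> J"
    and "determines J B f i (input_window J B f i)"
    and "W \<subseteq> J \<Longrightarrow> determines J B f i W \<Longrightarrow> input_window J B f i \<subseteq> W"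
proof -
  let ?P = "\<lambda>W. W \<subseteq> J \<and> determines J B f i W"
  have J: "?P J"
    by (simp add: determines_def PiE_restrict)
  have fin: "finite {W. ?P W}"
    by (rule finite_subset[of _ "Pow J"]) (use assms in auto)
  obtain M where M: "?P M" and min: "\<And>W. ?P W \<Longrightarrow> W \<subseteq> M \<Longrightarrow> W = M"
    using finite_has_minimal2[OF fin, of J] J by (metis (no_types, lifting) mem_Collect_eq)
  have least: "M \<subseteq> W" if "?P W" for W
  proof -
    have "?P (M \<inter> W)"
      using determines_Int[of M J B f i W] M that by (simp add: le_infI1)
    then show ?thesis
      using min[of "M \<inter> W"] by auto
  qed
  have "input_window J B f i = M"
    unfolding input_window_def by (rule Least_equality) (use M least in auto)
  then show "input_window J B f i \<subseteq> J" "determines J B f i (input_window J B f i)"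
    "W \<subseteq> J \<Longrightarrow> determines J B f i W \<Longrightarrow> input_window J B f i \<subseteq> W"
    using M least by auto
qed

definition simplicial_complex :: "'i set \<Rightarrow> 'i set set \<Rightarrow> bool" where
  "simplicial_complex I K \<longleftrightarrow>
     K \<subseteq> Pow I \<and> {} \<in> K \<and> (\<forall>S \<in> K. \<forall>T. T \<subseteq> S \<longrightarrow> T \<in> K)"

definition maximal_simplices :: "'i set set \<Rightarrow> 'i set set" where
  "maximal_simplices K = {S \<in> K. \<forall>T \<in> K. S \<subseteq> T \<longrightarrow> T = S}"

definition communication_complex ::
  "'i set \<Rightarrow> 'j set \<Rightarrow> 'b set \<Rightarrow> (('j \<Rightarrow> 'b) \<Rightarrow> ('i \<Rightarrow> 'a)) \<Rightarrow> 'i set set" where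
  "communication_complex I J B f =
     {S. S \<subseteq> I \<and> (S = {} \<or> (\<Inter>i \<in> S. input_window J B f i) \<noteq> {})}"

text \<open>
  HOL cannot quantify existentially over types. Every finite set is in bijection with a finite
  set of natural numbers, so the finite sets \<open>B\<close> and \<open>J\<close> are taken among the latter.
\<close>

definition generates :: "'i set \<Rightarrow> 'a set \<Rightarrow> 'i set set \<Rightarrow> ('i \<Rightarrow> 'a) set \<Rightarrow> bool" where
  "generates I A K L \<longleftrightarrow>
     (\<exists>(B :: nat set) (J :: nat set) f.
        finite B \<and> finite J \<and> f \<in> (J \<rightarrow>\<^sub>E B) \<rightarrow> (I \<rightarrow>\<^sub>E A) \<and>
        f ` (J \<rightarrow>\<^sub>E B) = L \<and> communication_complex I J B f \<subseteq> K)"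

definition minimal_generating :: "'i set \<Rightarrow> 'a set \<Rightarrow> 'i set set \<Rightarrow> ('i \<Rightarrow> 'a) set \<Rightarrow> bool" where
  "minimal_generating I A K L \<longleftrightarrow>
     simplicial_complex I K \<and> generates I A K L \<and>
     \<not> (\<exists>K'. simplicial_complex I K' \<and> K' \<subset> K \<and> generates I A K' L)"

definition one_or_all_ones :: "nat \<Rightarrow> (nat \<Rightarrow> nat) set" where
  "one_or_all_ones n =
     {u \<in> {0..<n} \<rightarrow>\<^sub>E {0, 1}. card {i \<in> {0..<n}. u i = 1} = 1 \<or> card {i \<in> {0..<n}. u i = 1} = n}"

end

theory Submission
  imports Defs
begin

text \<open>
  Upper bound: let the cell \<open>a\<close> see a first input, the cell \<open>b\<close> a second one, and all other cells
  both. If both \<open>a\<close> and \<open>b\<close> choose the value 1, the others output 1; if exactly one does, the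
  others output 0; if none does, the single 1 is put on one of the remaining cells, of which there
  is at least one since \<open>n \<ge> 3\<close>.

  Lower bound: for every cell \<open>c\<close> there is \<open>a \<noteq> c\<close> such that \<open>I\<^sub>n - {a}\<close> is a simplex. Otherwise,
  start from an input producing the constant word 1 and change, one by one, the inputs seen by \<open>c\<close>.
  Leaving the constant word by changing one input alters all cells but one, so this input would be
  in the windows of all cells except some \<open>a \<noteq> c\<close>, or in all windows. Hence the word remains
  constant, so the value of cell \<open>c\<close> is always 1, which is absurd. Applying this to an
  arbitrary cell gives \<open>a\<close>, and applying it to \<open>a\<close> gives a second cell \<open>b\<close>.
\<close>

section \<open>Words of the language and input windows\<close>

lemma one_or_all_ones_iff:
  assumes "n > 0"
  shows "u \<in> one_or_all_ones n \<longleftrightarrow>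
    u = (\<lambda>i\<in>{0..<n}. 1) \<or> (\<exists>k<n. u = (\<lambda>i\<in>{0..<n}. if i = k then 1 else 0))"
proof
  assume u: "u \<in> one_or_all_ones n"
  let ?S = "{i \<in> {0..<n}. u i = 1}"
  have PiE: "u \<in> {0..<n} \<rightarrow>\<^sub>E {0, 1}" and "card ?S = 1 \<or> card ?S = n"
    using u by (auto simp: one_or_all_ones_def)
  from this(2) show "u = (\<lambda>i\<in>{0..<n}. 1) \<or> (\<exists>k<n. u = (\<lambda>i\<in>{0..<n}. if i = k then 1 else 0))"
  proof
    assume "card ?S = 1"
    then obtain k where k: "?S = {k}"
      by (auto simp: card_1_singleton_iff)
    have "u = (\<lambda>i\<in>{0..<n}. if i = k then 1 else 0)"
    proof
      fix i
      show "u i = (\<lambda>i\<in>{0..<n}. if i = k then 1 else 0) i"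
        using PiE_mem[OF PiE, of i] PiE_arb[OF PiE, of i] k by (auto simp: set_eq_iff)
    qed
    moreover have "k < n"
      using k by auto
    ultimately show ?thesis
      by blast
  next
    assume "card ?S = n"
    then have S: "?S = {0..<n}"
      by (intro card_subset_eq) auto
    have "u = (\<lambda>i\<in>{0..<n}. 1)"
    proof
      fix i
      show "u i = (\<lambda>i\<in>{0..<n}. 1) i"
        using PiE_arb[OF PiE, of i] S by (auto simp: set_eq_iff)
    qed
    then show ?thesis ..
  qed
next
  assume "u = (\<lambda>i\<in>{0..<n}. 1) \<or> (\<exists>k<n. u = (\<lambda>i\<in>{0..<n}. if i = k then 1 else 0))"
  then show "u \<in> one_or_all_ones n"
  proof (elim disjE exE conjE)
    assume u: "u = (\<lambda>i\<in>{0..<n}. 1)"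
    then have "{i \<in> {0..<n}. u i = 1} = {0..<n}"
      by auto
    then show ?thesis
      by (simp add: one_or_all_ones_def) (simp add: u)
  next
    fix k assume u: "u = (\<lambda>i\<in>{0..<n}. if i = k then 1 else 0)" and "k < n"
    then have "{i \<in> {0..<n}. u i = 1} = {k}"
      by auto
    then show ?thesis
      by (simp add: one_or_all_ones_def) (simp add: u)
  qed
qed

text \<open>Otherwise \<open>x\<close> and \<open>y\<close> agree on the window, which determines
  the value of cell \<open>i\<close>. Windows are bounded from below this way: a change of one input
  that alters a cell shows that the cell sees this input.\<close>

lemma in_input_window:
  assumes "finite J" and "x \<in> J \<rightarrow>\<^sub>E B" and "y \<in> J \<rightarrow>\<^sub>E B"
    and "\<And>l. l \<noteq> j \<Longrightarrow> x l = y l" and "f x i \<noteq> f y i"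
  shows "j \<in> input_window J B f i"
proof (rule ccontr)
  assume "j \<notin> input_window J B f i"
  then have "restrict x (input_window J B f i) = restrict y (input_window J B f i)"
    using assms(4) by (metis restrict_ext)
  then show False
    using input_window_least(2)[OF assms(1), of B f i] assms(2,3,5)
    unfolding determines_def by blast
qed

section \<open>Complexes with two facets\<close>

definition two_facets :: "'i set \<Rightarrow> 'i \<Rightarrow> 'i \<Rightarrow> 'i set set" where
  "two_facets I a b = Pow (I - {a}) \<union> Pow (I - {b})"

lemma simplicial_complex_two_facets: "simplicial_complex I (two_facets I a b)"
  by (auto simp: simplicial_complex_def two_facets_def)

lemma maximal_simplices_two_facets:
  assumes "a \<in> I" "b \<in> I"
  shows "maximal_simplices (two_facets I a b) = {I - {a}, I - {b}}"
  using assms unfolding maximal_simplices_def two_facets_def by auto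

lemma two_facets_subset:
  assumes "simplicial_complex I K" "I - {a} \<in> K" "I - {b} \<in> K"
  shows "two_facets I a b \<subseteq> K"
  using assms unfolding simplicial_complex_def two_facets_def by blast

text \<open>A set omitting only \<open>c\<close> lies in one of the two facets only if
  \<open>c\<close> is \<open>a\<close> or \<open>b\<close>, and likewise for \<open>d\<close>; being
  distinct, they exhaust both. So these complexes form an antichain, whence their
  minimality.\<close>

lemma two_facets_subset_imp_eq:
  assumes "a \<in> I" "b \<in> I" "c \<in> I" "d \<in> I" "c \<noteq> d"
    and "two_facets I c d \<subseteq> two_facets I a b"
  shows "two_facets I c d = two_facets I a b"
proof -
  have "I - {c} \<in> two_facets I a b" "I - {d} \<in> two_facets I a b"
    using assms(6) by (auto simp: two_facets_def)
  then have "c \<in> {a, b}" "d \<in> {a, b}"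
    using assms(1,2) by (auto simp: two_facets_def)
  with \<open>c \<noteq> d\<close> show ?thesis
    by (auto simp: two_facets_def)
qed

lemma simplex_subset_maximal:
  assumes "finite I" "simplicial_complex I K" "S \<in> K"
  obtains M where "M \<in> maximal_simplices K" "S \<subseteq> M"
proof -
  have "finite K"
    using assms(1,2) by (auto simp: simplicial_complex_def intro: finite_subset)
  then obtain M where "M \<in> K" "S \<subseteq> M" "\<And>T. T \<in> K \<Longrightarrow> M \<subseteq> T \<Longrightarrow> T = M"
    using finite_has_maximal2[of K S] assms(3) by metis
  then show thesis
    using that[of M] by (auto simp: maximal_simplices_def)
qed

text \<open>A finite complex consists of the subsets of its maximal simplices.\<close>

lemma maximal_simplices_eq_two_facets:
  assumes "finite I" "simplicial_complex I K" "maximal_simplices K = {I - {a}, I - {b}}"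
  shows "K = two_facets I a b"
proof
  show "K \<subseteq> two_facets I a b"
  proof
    fix S assume "S \<in> K"
    then obtain M where "M \<in> {I - {a}, I - {b}}" "S \<subseteq> M"
      using simplex_subset_maximal[OF assms(1,2)] unfolding assms(3) by metis
    then show "S \<in> two_facets I a b"
      unfolding two_facets_def by blast
  qed
  have "maximal_simplices K \<subseteq> K"
    by (simp add: maximal_simplices_def)
  then show "two_facets I a b \<subseteq> K"
    using assms(3) by (intro two_facets_subset[OF assms(2)]) simp_all
qed

section \<open>Upper bound: generation by two facets\<close>

lemma generates_two_facets:
  assumes "n \<ge> 3" and ab: "a < n" "b < n" "a \<noteq> b"
  shows "generates {0..<n} {0, 1} (two_facets {0..<n} a b) (one_or_all_ones n)"
proof -
  have "\<not> {0..<n} \<subseteq> {a, b}"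
    using card_mono[of "{a, b}" "{0..<n}"] ab assms(1) by auto
  then obtain c where c: "c < n" "c \<noteq> a" "c \<noteq> b"
    by (auto simp: subset_iff)
  define J B :: "nat set" where "J = {0, 1}" and "B = {0..<n}"
  let ?e = "\<lambda>k. \<lambda>i\<in>{0..<n}. if i = k then 1 else 0 :: nat"
  \<comment> \<open>Inputs are names of cells: \<open>a\<close> chooses 1 when
    \<open>x 0 = a\<close>, and \<open>b\<close> when \<open>x 1 = b\<close>. If neither does,
    \<open>x 0\<close> names the cell carrying the 1. The value \<open>b\<close> is then redirected
    to \<open>c\<close>, since \<open>b\<close> does not see \<open>x 0\<close> and has to output
    0.\<close>
  define f :: "(nat \<Rightarrow> nat) \<Rightarrow> nat \<Rightarrow> nat" where
    "f x = (if x 0 = a then if x 1 = b then \<lambda>i\<in>{0..<n}. 1 else ?e a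
            else if x 1 = b then ?e b else if x 0 = b then ?e c else ?e (x 0))" for x
  have J: "finite J"
    by (simp add: J_def)
  have fL: "f x \<in> one_or_all_ones n" if "x \<in> J \<rightarrow>\<^sub>E B" for x
  proof -
    have "x 0 < n"
      using PiE_mem[OF that, of 0] by (simp add: J_def B_def)
    then show ?thesis
      using ab c(1) assms(1) by (auto simp: one_or_all_ones_iff f_def)
  qed
  have "one_or_all_ones n \<subseteq> f ` (J \<rightarrow>\<^sub>E B)"
  proof
    fix u assume "u \<in> one_or_all_ones n"
    then consider "u = (\<lambda>i\<in>{0..<n}. 1)" | k where "k < n" "u = ?e k"
      using assms(1) by (auto simp: one_or_all_ones_iff)
    then have "\<exists>p<n. \<exists>q<n. u = f (\<lambda>j\<in>J. if j = 0 then p else q)"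
    proof cases
      case 1
      then have "u = f (\<lambda>j\<in>J. if j = 0 then a else b)"
        by (simp add: f_def J_def)
      with ab show ?thesis
        by blast
    next
      case 2
      \<comment> \<open>The second input \<open>c\<close> stands for \<open>b\<close> not choosing
        1, so that the first input places the 1, also when \<open>k = a\<close>.\<close>
      then have "u = f (\<lambda>j\<in>J. if j = 0 then k else if k = b then b else c)"
        using ab c by (simp add: f_def J_def)
      with 2 ab c show ?thesis
        by (metis (full_types))
    qed
    then obtain p q where pq: "p < n" "q < n" "u = f (\<lambda>j\<in>J. if j = 0 then p else q)"
      by blast
    have "(\<lambda>j\<in>J. if j = 0 then p else q) \<in> J \<rightarrow>\<^sub>E B"
      using pq by (auto simp: B_def)
    with pq(3) show "u \<in> f ` (J \<rightarrow>\<^sub>E B)"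
      by blast
  qed
  with fL have img: "f ` (J \<rightarrow>\<^sub>E B) = one_or_all_ones n"
    by blast
  have maps: "f \<in> (J \<rightarrow>\<^sub>E B) \<rightarrow> ({0..<n} \<rightarrow>\<^sub>E {0, 1})"
    using fL by (auto simp: one_or_all_ones_def)
  have wa: "input_window J B f a \<subseteq> {0}"
  proof (rule input_window_least(3)[OF J])
    have fa: "f x a = (if x 0 = a then 1 else 0)" for x
      using ab c by (simp add: f_def)
    show "determines J B f a {0}"
      unfolding determines_def fa by (metis restrict_apply' singletonI)
  qed (simp add: J_def)
  have wb: "input_window J B f b \<subseteq> {1}"
  proof (rule input_window_least(3)[OF J])
    have fb: "f x b = (if x 1 = b then 1 else 0)" for x
      using ab c by (simp add: f_def)
    show "determines J B f b {1}"
      unfolding determines_def fb by (metis restrict_apply' singletonI)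
  qed (simp add: J_def)
  \<comment> \<open>The windows of \<open>a\<close> and \<open>b\<close> are disjoint, so no simplex
    contains both cells.\<close>
  have "communication_complex {0..<n} J B f \<subseteq> two_facets {0..<n} a b"
    using wa wb by (fastforce simp: communication_complex_def two_facets_def)
  with img maps show ?thesis
    unfolding generates_def by (intro exI[of _ B] exI[of _ J] exI[of _ f]) (simp add: J_def B_def)
qed

section \<open>Lower bound: facets forced by the constant word\<close>

lemma generating_has_facet_avoiding:
  assumes "n \<ge> 2" "c < n"
    and J: "finite J" and img: "f ` (J \<rightarrow>\<^sub>E B) = one_or_all_ones n"
  shows "\<exists>a<n. a \<noteq> c \<and> {0..<n} - {a} \<in> communication_complex {0..<n} J B f"
proof (rule ccontr)
  let ?C = "communication_complex {0..<n} J B f"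
  assume contra: "\<not> ?thesis"
  have facetI: "{0..<n} - {a} \<in> ?C" if "\<And>i. i < n \<Longrightarrow> i \<noteq> a \<Longrightarrow> j \<in> input_window J B f i" for a j
  proof -
    have "j \<in> (\<Inter>i \<in> {0..<n} - {a}. input_window J B f i)"
      using that by auto
    then show ?thesis
      unfolding communication_complex_def by blast
  qed
  let ?one = "\<lambda>i\<in>{0..<n}. 1 :: nat"
  obtain k where k: "k < n" "k \<noteq> c"
    using assms(1) by (metis One_nat_def less_2_cases_iff less_le_trans zero_neq_one)
  have "?one \<in> one_or_all_ones n" "(\<lambda>i\<in>{0..<n}. if i = k then 1 else 0) \<in> one_or_all_ones n"
    using assms(1) k(1) by (auto simp: one_or_all_ones_iff)
  then obtain x y where x: "x \<in> J \<rightarrow>\<^sub>E B" "f x = ?one"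
    and y: "y \<in> J \<rightarrow>\<^sub>E B" "f y = (\<lambda>i\<in>{0..<n}. if i = k then 1 else 0)"
    unfolding img[symmetric] by (metis (no_types, lifting) imageE)
  let ?W = "input_window J B f c"
  \<comment> \<open>\<open>z F\<close> interpolates from \<open>x\<close> to \<open>y\<close>: the
    inputs in \<open>F\<close> have already been changed.\<close>
  define z where "z F = (\<lambda>j. if j \<in> F then y j else x j)" for F
  have z: "z F \<in> J \<rightarrow>\<^sub>E B" for F
    using x(1) y(1) by (auto simp: z_def PiE_iff extensional_def)
  have "finite ?W"
    using input_window_least(1)[OF J] J by (rule finite_subset)
  from this subset_refl[of ?W] have "f (z ?W) = ?one"
  proof (induction rule: finite_subset_induct')
    case empty
    then show ?case
      using x(2) by (simp add: z_def)
  next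
    case (insert j F)
    have win: "j \<in> input_window J B f i" if "f (z F) i \<noteq> f (z (insert j F)) i" for i
      using that by (rule in_input_window[OF J z z, rotated]) (simp add: z_def)
    show ?case
    proof (rule ccontr)
      assume "f (z (insert j F)) \<noteq> ?one"
      moreover have "f (z (insert j F)) \<in> one_or_all_ones n"
        using img z by blast
      ultimately obtain a where a: "a < n" "f (z (insert j F)) = (\<lambda>i\<in>{0..<n}. if i = a then 1 else 0)"
        using assms(1) by (auto simp: one_or_all_ones_iff)
      have W: "j \<in> input_window J B f i" if "i < n" "i \<noteq> a" for i
        using that a(2) insert by (intro win) simp
      show False
      proof (cases "a = c")
        \<comment> \<open>Here \<open>W\<close> says nothing about \<open>c\<close> itself, but
          \<open>j\<close> was taken from the window of \<open>c\<close>. Hence all cells see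
          \<open>j\<close>, and any cell other than \<open>c\<close>, such as \<open>k\<close>, may
          be omitted.\<close>
        case True
        with W insert.hyps have "{0..<n} - {k} \<in> ?C"
          by (intro facetI[of _ j]) auto
        with contra k show False
          by blast
      next
        case False
        with contra a(1) facetI[OF W] show False
          by blast
      qed
    qed
  qed
  \<comment> \<open>Once its whole window is changed, \<open>c\<close> cannot distinguish the input
    from \<open>y\<close>, where it outputs 0 because \<open>k\<close> differs from
    \<open>c\<close>.\<close>
  moreover have "f (z ?W) c = f y c"
  proof -
    have "restrict (z ?W) ?W = restrict y ?W"
      by (rule restrict_ext) (simp add: z_def)
    then show ?thesis
      using input_window_least(2)[OF J, of B f c] z y(1) unfolding determines_def by blast
  qed
  ultimately show False
    using y(2) k(2) assms(2) by simp
qed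

section \<open>Minimal generating complexes\<close>

lemma generating_contains_two_facets:
  assumes "n \<ge> 2" "simplicial_complex {0..<n} K"
    and "generates {0..<n} A K (one_or_all_ones n)"
  obtains a b where "a < n" "b < n" "a \<noteq> b" "two_facets {0..<n} a b \<subseteq> K"
proof -
  obtain B J :: "nat set" and f where J: "finite J" and img: "f ` (J \<rightarrow>\<^sub>E B) = one_or_all_ones n"
    and sub: "communication_complex {0..<n} J B f \<subseteq> K"
    using assms(3) unfolding generates_def by blast
  note facet = generating_has_facet_avoiding[OF assms(1) _ J img]
  obtain a where a: "a < n" "{0..<n} - {a} \<in> K"
    using facet[of 0] assms(1) sub by auto
  obtain b where b: "b < n" "b \<noteq> a" "{0..<n} - {b} \<in> K"
    using facet[OF a(1)] sub by auto
  show thesis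
    using that[of a b] a b two_facets_subset[OF assms(2) a(2) b(3)] by auto
qed

lemma minimal_generating_iff:
  assumes "n \<ge> 3"
  shows "minimal_generating {0..<n} {0, 1} K (one_or_all_ones n) \<longleftrightarrow>
    (\<exists>a<n. \<exists>b<n. a \<noteq> b \<and> K = two_facets {0..<n} a b)"
proof
  assume K: "minimal_generating {0..<n} {0, 1} K (one_or_all_ones n)"
  then have "simplicial_complex {0..<n} K" "generates {0..<n} {0, 1} K (one_or_all_ones n)"
    by (simp_all add: minimal_generating_def)
  then obtain a b where ab: "a < n" "b < n" "a \<noteq> b" "two_facets {0..<n} a b \<subseteq> K"
    using assms by (elim generating_contains_two_facets[rotated]) auto
  \<comment> \<open>The smaller complex generates the language by itself, so strict inclusion would
    contradict minimality.\<close>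
  moreover have "\<not> two_facets {0..<n} a b \<subset> K"
    using K generates_two_facets[OF assms ab(1-3)] simplicial_complex_two_facets[of "{0..<n}" a b]
    unfolding minimal_generating_def by metis
  ultimately have "K = two_facets {0..<n} a b"
    by (simp add: psubset_eq)
  with ab show "\<exists>a<n. \<exists>b<n. a \<noteq> b \<and> K = two_facets {0..<n} a b"
    by blast
next
  assume "\<exists>a<n. \<exists>b<n. a \<noteq> b \<and> K = two_facets {0..<n} a b"
  then obtain a b where ab: "a < n" "b < n" "a \<noteq> b" and K: "K = two_facets {0..<n} a b"
    by blast
  have "\<not> K' \<subset> K"
    if K': "simplicial_complex {0..<n} K'" "generates {0..<n} {0, 1} K' (one_or_all_ones n)" for K'
  proof
    assume "K' \<subset> K"
    obtain c d where cd: "c < n" "d < n" "c \<noteq> d" "two_facets {0..<n} c d \<subseteq> K'"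
      using generating_contains_two_facets[OF _ K'] assms by auto
    \<comment> \<open>Any generating \<open>K'\<close> strictly below \<open>K\<close> would squeeze
      in another complex of the same form, against the antichain property.\<close>
    with \<open>K' \<subset> K\<close> have "two_facets {0..<n} c d \<subset> two_facets {0..<n} a b"
      using K by blast
    with cd ab two_facets_subset_imp_eq[of a "{0..<n}" b c d] show False
      by auto
  qed
  then show "minimal_generating {0..<n} {0, 1} K (one_or_all_ones n)"
    using generates_two_facets[OF assms ab] simplicial_complex_two_facets[of "{0..<n}" a b] K
    unfolding minimal_generating_def by metis
qed

theorem proposition3p4:
  fixes n :: nat
  assumes "n \<ge> 3"
  shows "{K. minimal_generating {0..<n} {0, 1} K (one_or_all_ones n)} =
         {K. simplicial_complex {0..<n} K \<and>
             (\<exists>a \<in> {0..<n}. \<exists>b \<in> {0..<n}. a \<noteq> b \<and>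
                maximal_simplices K = {{0..<n} - {a}, {0..<n} - {b}})}"
proof -
  \<comment> \<open>Since a finite complex is recovered from its maximal simplices, the
    characterisation by \<open>two_facets\<close> becomes one by facets.\<close>
  have facets: "K = two_facets {0..<n} a b \<longleftrightarrow>
      simplicial_complex {0..<n} K \<and> maximal_simplices K = {{0..<n} - {a}, {0..<n} - {b}}"
    if "a < n" "b < n" for K a b
    using that maximal_simplices_eq_two_facets[of "{0..<n}" K a b]
      maximal_simplices_two_facets[of a "{0..<n}" b] simplicial_complex_two_facets[of "{0..<n}" a b]
    by fastforce
  show ?thesis
  proof (rule Collect_cong)
    fix K
    show "minimal_generating {0..<n} {0, 1} K (one_or_all_ones n) \<longleftrightarrow>
      simplicial_complex {0..<n} K \<and> (\<exists>a \<in> {0..<n}. \<exists>b \<in> {0..<n}. a \<noteq> b \<and>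
        maximal_simplices K = {{0..<n} - {a}, {0..<n} - {b}})" (is "?L \<longleftrightarrow> ?R")
    proof
      assume ?L
      then obtain a b where "a < n" "b < n" "a \<noteq> b" "K = two_facets {0..<n} a b"
        unfolding minimal_generating_iff[OF assms] by blast
      with facets[of a b K] show ?R
        by (metis atLeastLessThan_iff zero_le)
    next
      assume R: ?R
      then obtain a b where "a < n" "b < n" "a \<noteq> b"
        "maximal_simplices K = {{0..<n} - {a}, {0..<n} - {b}}"
        by (metis atLeastLessThan_iff)
      with R facets[of a b K] show ?L
        unfolding minimal_generating_iff[OF assms] by metis
    qed
  qed
qed

end
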